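(* Let $(X,d)$ be a metric space and let $\mathfrak B$ be a bornology with closed base on $X$ such that $X\notin\mathfrak B$ and $X$ is $\mathfrak B^s$-Lindelöf. The following are equivalent: (1) the space $(\mathsf C(X),\tau_{\mathfrak B}^s)$ has countable fan tightness; (2) $X$ satisfies $\mathsf S_{fin}(\mathcal O_{\mathfrak B^s},\mathcal O_{\mathfrak B^s})$.
   Context: A bornology on a metric space $(X,d)$ is a family $\mathfrak B$ of nonempty subsets of $X$ that is closed under finite unions, closed under taking nonempty subsets, and covers $X$. A base for $\mathfrak B$ is a subfamily $\mathfrak B_0\subset\mathfrak B$ such that every $B\in\mathfrak B$ is contained in some $B_0\in\mathfrak B_0$; it is a closed base if all its members are closed in $X$. For $A\subset X$ and $\varepsilon>0$, $A^{\varepsilon}=\bigcup_{a\in A}\{y\in X: d(a,y)<\varepsilon\}$. $\mathsf C(X)$ is the set of all continuous functions $X\to\mathbb R$. The topology $\tau_{\mathfrak B}^s$ of strong uniform convergence on $\mathfrak B$ is the topology on $\mathsf C(X)$ in which each $f$ has as a local base the sets $[B,\varepsilon]^s(f)=\{g\in\mathsf C(X):\exists\delta>0\ \forall x\in B^{\delta}\ |g(x)-f(x)|<\varepsilon\}$, for $B\in\mathfrak B$ and $\varepsilon>0$. A strong $\mathfrak B$-cover ($\mathfrak B^s$-cover) of $X$ is an open cover $\mathcal U$ of $X$ such that $X\notin\mathcal U$ and for each $B\in\mathfrak B$ there are $U\in\mathcal U$ and $\delta>0$ with $B^{\delta}\subset U$. $\mathcal O_{\mathfrak B^s}$ is the collection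 of all $\mathfrak B^s$-covers of $X$. $X$ is $\mathfrak B^s$-Lindelöf if every $\mathfrak B^s$-cover of $X$ contains a countable subfamily that is a $\mathfrak B^s$-cover. For families $\mathfrak U,\mathfrak V$, $\mathsf S_{fin}(\mathfrak U,\mathfrak V)$ is the statement: for each sequence $(U_n:n\in\mathbb N)$ of elements of $\mathfrak U$ there is a sequence $(V_n:n\in\mathbb N)$ such that $V_n$ is a finite subset of $U_n$ for each $n$ and $\bigcup_{n\in\mathbb N}V_n\in\mathfrak V$. For a topological space $Z$ and $z\in Z$, $\Omega_z=\{A\subset Z\setminus\{z\}: z\in\overline A\}$. $Z$ has countable fan tightness if $\mathsf S_{fin}(\Omega_z,\Omega_z)$ holds for each $z\in Z$. *)

theory Defs
  imports "HOL-Analysis.Analysis"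
begin

text \<open>The metric space \<open>X\<close> is the universe of a type of class \<^class>\<open>metric_space\<close>.\<close>

text \<open>Only unions of nonempty finite subfamilies are required to be members,
  since members of a bornology are nonempty.\<close>

definition bornology :: "'a::metric_space set set \<Rightarrow> bool" where
  "bornology \<BB> \<longleftrightarrow>
     {} \<notin> \<BB> \<and>
     (\<forall>\<F>. finite \<F> \<and> \<F> \<noteq> {} \<and> \<F> \<subseteq> \<BB> \<longrightarrow> \<Union>\<F> \<in> \<BB>) \<and>
     (\<forall>B\<in>\<BB>. \<forall>A. A \<noteq> {} \<and> A \<subseteq> B \<longrightarrow> A \<in> \<BB>) \<and>
     \<Union>\<BB> = UNIV"

definition bornology_base :: "'a::metric_space set set \<Rightarrow> 'a set set \<Rightarrow> bool" where
  "bornology_base \<BB> \<BB>\<^sub>0 \<longleftrightarrow> \<BB>\<^sub>0 \<subseteq> \<BB> \<and> (\<forall>B\<in>\<BB>. \<exists>B\<^sub>0\<in>\<BB>\<^sub>0. B \<subseteq> B\<^sub>0)"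

definition has_closed_base :: "'a::metric_space set set \<Rightarrow> bool" where
  "has_closed_base \<BB> \<longleftrightarrow> (\<exists>\<BB>\<^sub>0. bornology_base \<BB> \<BB>\<^sub>0 \<and> (\<forall>B\<in>\<BB>\<^sub>0. closed B))"

definition enlargement :: "'a::metric_space set \<Rightarrow> real \<Rightarrow> 'a set" where
  "enlargement A \<epsilon> = (\<Union>a\<in>A. ball a \<epsilon>)"

definition cont_funs :: "('a::metric_space \<Rightarrow> real) set" where
  "cont_funs = {f. continuous_on UNIV f}"

definition strong_nbhd ::
  "'a::metric_space set \<Rightarrow> real \<Rightarrow> ('a \<Rightarrow> real) \<Rightarrow> ('a \<Rightarrow> real) set" where
  "strong_nbhd B \<epsilon> f =
     {g \<in> cont_funs. \<exists>\<delta>>0. \<forall>x\<in>enlargement B \<delta>. \<bar>g x - f x\<bar> < \<epsilon>}"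

text \<open>The sets \<^term>\<open>strong_nbhd B \<epsilon> f\<close> need not be open; they form a local base in the sense of
  a base of the neighbourhood filter of \<open>f\<close>. The facts below confirm, for a bornology, that
  the predicate is a topology on \<^term>\<open>cont_funs\<close> and that it has these local bases
  (which determine it).\<close>

definition strong_uniform_topology ::
  "'a::metric_space set set \<Rightarrow> ('a \<Rightarrow> real) topology" where
  "strong_uniform_topology \<BB> =
     topology (\<lambda>W. W \<subseteq> cont_funs \<and> (\<forall>f\<in>W. \<exists>B\<in>\<BB>. \<exists>\<epsilon>>0. strong_nbhd B \<epsilon> f \<subseteq> W))"

definition strong_cover :: "'a::metric_space set set \<Rightarrow> 'a set set \<Rightarrow> bool" where
  "strong_cover \<BB> \<U> \<longleftrightarrow>
     (\<forall>U\<in>\<U>. open U) \<and> \<Union>\<U> = UNIV \<and> UNIV \<notin> \<U> \<and>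
     (\<forall>B\<in>\<BB>. \<exists>U\<in>\<U>. \<exists>\<delta>>0. enlargement B \<delta> \<subseteq> U)"

definition strong_covers :: "'a::metric_space set set \<Rightarrow> 'a set set set" where
  "strong_covers \<BB> = {\<U>. strong_cover \<BB> \<U>}"

definition strong_Lindelof :: "'a::metric_space set set \<Rightarrow> bool" where
  "strong_Lindelof \<BB> \<longleftrightarrow>
     (\<forall>\<U>\<in>strong_covers \<BB>. \<exists>\<V>\<subseteq>\<U>. countable \<V> \<and> \<V> \<in> strong_covers \<BB>)"

definition S_fin :: "'b set set \<Rightarrow> 'b set set \<Rightarrow> bool" where
  "S_fin \<UU> \<VV> \<longleftrightarrow>
     (\<forall>U :: nat \<Rightarrow> 'b set. (\<forall>n. U n \<in> \<UU>) \<longrightarrow>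
        (\<exists>V :: nat \<Rightarrow> 'b set. (\<forall>n. finite (V n) \<and> V n \<subseteq> U n) \<and> (\<Union>n. V n) \<in> \<VV>))"

definition Omega_at :: "'b topology \<Rightarrow> 'b \<Rightarrow> 'b set set" where
  "Omega_at Z z = {A. A \<subseteq> topspace Z - {z} \<and> z \<in> Z closure_of A}"

definition countable_fan_tightness :: "'b topology \<Rightarrow> bool" where
  "countable_fan_tightness Z \<longleftrightarrow>
     (\<forall>z\<in>topspace Z. S_fin (Omega_at Z z) (Omega_at Z z))"

lemma bornology_Un: "bornology \<BB> \<Longrightarrow> A \<in> \<BB> \<Longrightarrow> B \<in> \<BB> \<Longrightarrow> A \<union> B \<in> \<BB>"
  unfolding bornology_def
  by (metis Union_insert ccpo_Sup_singleton empty_subsetI finite.emptyI finite.insertI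
      insert_not_empty insert_subset)

lemma bornology_nonempty: "bornology (\<BB> :: 'a::metric_space set set) \<Longrightarrow> \<exists>B. B \<in> \<BB>"
  unfolding bornology_def by blast

lemma strong_nbhd_mono:
  assumes "A \<subseteq> B" "\<epsilon> \<le> \<eta>"
  shows "strong_nbhd B \<epsilon> f \<subseteq> strong_nbhd A \<eta> f"
  using assms unfolding strong_nbhd_def enlargement_def by fastforce

lemma strong_nbhd_self: "f \<in> cont_funs \<Longrightarrow> \<epsilon> > 0 \<Longrightarrow> f \<in> strong_nbhd B \<epsilon> f"
  unfolding strong_nbhd_def by (auto intro: exI[of _ 1])

lemma strong_nbhd_triangle:
  assumes "g \<in> strong_nbhd B \<epsilon> f" "h \<in> strong_nbhd B \<eta> g"
  shows "h \<in> strong_nbhd B (\<epsilon> + \<eta>) f"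
proof -
  obtain d where d: "d > 0" "\<forall>x\<in>enlargement B d. \<bar>g x - f x\<bar> < \<epsilon>"
    using assms(1) by (auto simp: strong_nbhd_def)
  obtain e where e: "e > 0" "\<forall>x\<in>enlargement B e. \<bar>h x - g x\<bar> < \<eta>"
    using assms(2) by (auto simp: strong_nbhd_def)
  have "\<forall>x\<in>enlargement B (min d e). \<bar>h x - f x\<bar> < \<epsilon> + \<eta>"
  proof
    fix x assume "x \<in> enlargement B (min d e)"
    then have "x \<in> enlargement B d" "x \<in> enlargement B e"
      by (auto simp: enlargement_def)
    then have "\<bar>g x - f x\<bar> < \<epsilon>" "\<bar>h x - g x\<bar> < \<eta>"
      using d e by auto
    then show "\<bar>h x - f x\<bar> < \<epsilon> + \<eta>" by linarith
  qed
  moreover have "min d e > 0" using d e by simp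
  ultimately show ?thesis using assms(2) unfolding strong_nbhd_def by blast
qed

lemma openin_strong_uniform_topology:
  assumes "bornology \<BB>"
  shows "openin (strong_uniform_topology \<BB>) W \<longleftrightarrow>
    W \<subseteq> cont_funs \<and> (\<forall>f\<in>W. \<exists>B\<in>\<BB>. \<exists>\<epsilon>>0. strong_nbhd B \<epsilon> f \<subseteq> W)"
proof -
  let ?P = "\<lambda>W. W \<subseteq> cont_funs \<and> (\<forall>f\<in>W. \<exists>B\<in>\<BB>. \<exists>\<epsilon>>0. strong_nbhd B \<epsilon> f \<subseteq> W)"
  have "istopology ?P"
    unfolding istopology_def
  proof (intro conjI allI impI)
    fix S T assume S: "?P S" and T: "?P T"
    show "S \<inter> T \<subseteq> cont_funs" using S by blast
    show "\<forall>f\<in>S \<inter> T. \<exists>B\<in>\<BB>. \<exists>\<epsilon>>0. strong_nbhd B \<epsilon> f \<subseteq> S \<inter> T"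
    proof
      fix f assume f: "f \<in> S \<inter> T"
      obtain A a where A: "A \<in> \<BB>" "a > 0" "strong_nbhd A a f \<subseteq> S" using S f by blast
      obtain B b where B: "B \<in> \<BB>" "b > 0" "strong_nbhd B b f \<subseteq> T" using T f by blast
      have "strong_nbhd (A \<union> B) (min a b) f \<subseteq> S \<inter> T"
        using strong_nbhd_mono[of A "A \<union> B" "min a b" a f]
          strong_nbhd_mono[of B "A \<union> B" "min a b" b f] A B by auto
      moreover have "A \<union> B \<in> \<BB>" using bornology_Un assms A B by blast
      moreover have "min a b > 0" using A B by simp
      ultimately show "\<exists>B\<in>\<BB>. \<exists>\<epsilon>>0. strong_nbhd B \<epsilon> f \<subseteq> S \<inter> T" by blast
    qed
  next
    fix K assume K: "\<forall>S\<in>K. ?P S"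
    show "\<Union>K \<subseteq> cont_funs" using K by blast
    show "\<forall>f\<in>\<Union>K. \<exists>B\<in>\<BB>. \<exists>\<epsilon>>0. strong_nbhd B \<epsilon> f \<subseteq> \<Union>K"
      using K by (meson Union_iff Union_upper subset_trans)
  qed
  then show ?thesis unfolding strong_uniform_topology_def by (simp add: topology_inverse')
qed

lemma topspace_strong_uniform_topology:
  assumes "bornology (\<BB> :: 'a::metric_space set set)"
  shows "topspace (strong_uniform_topology \<BB>) = cont_funs"
proof -
  obtain B where "B \<in> \<BB>" using bornology_nonempty assms by blast
  moreover have "strong_nbhd B 1 f \<subseteq> cont_funs" for f by (auto simp: strong_nbhd_def)
  ultimately have "openin (strong_uniform_topology \<BB>) cont_funs"
    unfolding openin_strong_uniform_topology[OF assms] by (meson order_refl zero_less_one)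
  then show ?thesis
    by (meson assms openin_strong_uniform_topology openin_subset openin_topspace subset_antisym)
qed

lemma strong_uniform_topology_local_base:
  assumes "bornology \<BB>" "f \<in> cont_funs"
  shows "(\<exists>W. openin (strong_uniform_topology \<BB>) W \<and> f \<in> W \<and> W \<subseteq> N) \<longleftrightarrow>
    (\<exists>B\<in>\<BB>. \<exists>\<epsilon>>0. strong_nbhd B \<epsilon> f \<subseteq> N)"
proof
  assume "\<exists>W. openin (strong_uniform_topology \<BB>) W \<and> f \<in> W \<and> W \<subseteq> N"
  then show "\<exists>B\<in>\<BB>. \<exists>\<epsilon>>0. strong_nbhd B \<epsilon> f \<subseteq> N"
    unfolding openin_strong_uniform_topology[OF assms(1)] by (meson subset_trans)
next
  assume "\<exists>B\<in>\<BB>. \<exists>\<epsilon>>0. strong_nbhd B \<epsilon> f \<subseteq> N"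
  then obtain B e where B: "B \<in> \<BB>" "e > 0" "strong_nbhd B e f \<subseteq> N" by blast
  define W where "W = {g \<in> cont_funs. \<exists>A\<in>\<BB>. \<exists>\<epsilon>>0. strong_nbhd A \<epsilon> g \<subseteq> N}"
  have "f \<in> W" using B assms by (auto simp: W_def)
  moreover have "W \<subseteq> N" using strong_nbhd_self by (fastforce simp: W_def)
  moreover have "openin (strong_uniform_topology \<BB>) W"
    unfolding openin_strong_uniform_topology[OF assms(1)]
  proof (intro conjI ballI)
    show "W \<subseteq> cont_funs" by (auto simp: W_def)
    fix g assume "g \<in> W"
    then obtain A d where A: "A \<in> \<BB>" "d > 0" "strong_nbhd A d g \<subseteq> N" by (auto simp: W_def)
    have "strong_nbhd A (d/2) g \<subseteq> W"
    proof
      fix h assume h: "h \<in> strong_nbhd A (d/2) g"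
      then have "strong_nbhd A (d/2) h \<subseteq> N"
        using strong_nbhd_triangle[OF h, of _ "d/2"] A by auto
      moreover have "h \<in> cont_funs" using h by (auto simp: strong_nbhd_def)
      moreover have "d/2 > 0" using A by simp
      ultimately show "h \<in> W" using A unfolding W_def by blast
    qed
    then show "\<exists>B\<in>\<BB>. \<exists>\<epsilon>>0. strong_nbhd B \<epsilon> g \<subseteq> W"
      using A by (meson half_gt_zero)
  qed
  ultimately show "\<exists>W. openin (strong_uniform_topology \<BB>) W \<and> f \<in> W \<and> W \<subseteq> N" by blast
qed

end

theory Submission
  imports Defs
begin

text \<open>Given strong covers \<open>\<U>\<^sub>n\<close>, the zero function is a limit of the functions that equal \<open>1\<close>
  off some member of \<open>\<U>\<^sub>n\<close>, and a function that is smaller than \<open>1\<close> near \<open>B\<close> singles out a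
  member containing an enlargement of \<open>B\<close>. Conversely, functions \<open>g\<close> accumulating at \<open>f\<close> give
  the strong cover by the sets where \<open>g\<close> is within \<open>1/(n+1)\<close> of \<open>f\<close>, unless one of these sets
  is the whole space. If the latter happens for infinitely many \<open>n\<close>, some choice of the
  \<open>g\<close> converges uniformly to \<open>f\<close>. Otherwise the selection principle applies to a tail of the
  sequence, and it yields indices as large as needed because the members of a strong cover
  containing an enlargement of a given \<open>B\<close> cannot all belong to a finite subfamily.\<close>

section \<open>Enlargements, bornologies and strong covers\<close>

lemma mem_enlargement_iff_infdist:
  assumes "B \<noteq> {}"
  shows "x \<in> enlargement B \<delta> \<longleftrightarrow> infdist x B < \<delta>"
proof -
  \<comment> \<open>An infimum is below \<delta> iff one of the distances is. Nonemptiness matters: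
    \<open>infdist\<close> to the empty set is 0 by convention, while its enlargement is
    empty.\<close>
  have "infdist x B < \<delta> \<longleftrightarrow> (\<exists>b\<in>B. dist x b < \<delta>)"
    unfolding infdist_notempty[OF assms] by (rule cINF_less_iff) (use assms in auto)
  then show ?thesis
    by (auto simp: enlargement_def dist_commute)
qed

lemma subset_enlargement: "\<delta> > 0 \<Longrightarrow> B \<subseteq> enlargement B \<delta>"
  by (force simp: enlargement_def)

lemma enlargement_mono: "A \<subseteq> B \<Longrightarrow> enlargement A \<delta> \<subseteq> enlargement B \<delta>"
  by (auto simp: enlargement_def)

lemma bornology_singleton: "bornology \<BB> \<Longrightarrow> {x} \<in> \<BB>"
  unfolding bornology_def by (metis UNIV_I UnionE empty_subsetI insert_not_empty insert_subset)

lemma bornology_Un_finite: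
  assumes "bornology \<BB>" "B \<in> \<BB>" "finite F"
  shows "B \<union> F \<in> \<BB>"
  using assms(3)
proof induction
  case empty
  then show ?case using assms(2) by simp
next
  case (insert x F)
  then show ?case
    using bornology_Un[OF assms(1) bornology_singleton[OF assms(1), of x]] by fastforce
qed

text \<open>Covering comes from the last premise at singletons, which belong to every
  bornology.\<close>

lemma strong_coverI:
  assumes "bornology \<BB>" "\<And>U. U \<in> \<U> \<Longrightarrow> open U" "UNIV \<notin> \<U>"
    and "\<And>B. B \<in> \<BB> \<Longrightarrow> \<exists>U\<in>\<U>. \<exists>\<delta>>0. enlargement B \<delta> \<subseteq> U"
  shows "strong_cover \<BB> \<U>"
proof -
  have "x \<in> \<Union>\<U>" for x
    using assms(4)[OF bornology_singleton[OF assms(1), of x]] subset_enlargement by blast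
  then show ?thesis
    using assms(2-4) unfolding strong_cover_def by blast
qed

text \<open>Adding to \<open>B\<close> a point outside each member of \<open>\<F>\<close> rules out the members of \<open>\<F>\<close>.\<close>

lemma strong_cover_avoid_finite:
  assumes "bornology \<BB>" "strong_cover \<BB> \<U>" "B \<in> \<BB>" "finite \<F>" "\<F> \<subseteq> \<U>"
  obtains U \<delta> where "U \<in> \<U> - \<F>" "\<delta> > 0" "enlargement B \<delta> \<subseteq> U"
proof -
  have "\<forall>U\<in>\<F>. \<exists>x. x \<notin> U"
    using assms(2,5) unfolding strong_cover_def by (metis UNIV_eq_I subsetD)
  then obtain p where p: "\<And>U. U \<in> \<F> \<Longrightarrow> p U \<notin> U"
    by metis
  have "B \<union> p ` \<F> \<in> \<BB>"
    using bornology_Un_finite assms(1,3,4) by blast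
  then obtain U \<delta> where U: "U \<in> \<U>" "\<delta> > 0" "enlargement (B \<union> p ` \<F>) \<delta> \<subseteq> U"
    using assms(2) unfolding strong_cover_def by blast
  moreover have "U \<notin> \<F>"
    using p subset_enlargement[OF U(2), of "B \<union> p ` \<F>"] U(3) by blast
  moreover have "enlargement B \<delta> \<subseteq> U"
    using U(3) enlargement_mono[of B "B \<union> p ` \<F>" \<delta>] by blast
  ultimately show thesis
    using that by blast
qed

section \<open>Closures in the topology of strong uniform convergence\<close>

lemma in_closure_of_strong_uniform_topology:
  assumes "bornology \<BB>" "f \<in> cont_funs"
  shows "f \<in> strong_uniform_topology \<BB> closure_of A \<longleftrightarrow>
    (\<forall>B\<in>\<BB>. \<forall>\<epsilon>>0. \<exists>g\<in>A. g \<in> strong_nbhd B \<epsilon> f)"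
proof -
  \<comment> \<open>Phrasing closure as "no open set around \<open>f\<close> fits into
    \<open>- A\<close>" lets the local base lemma apply with \<open>N = - A\<close>, although the
    sets \<open>strong_nbhd B \<epsilon> f\<close> need not be open.\<close>
  have "f \<in> strong_uniform_topology \<BB> closure_of A \<longleftrightarrow>
    \<not> (\<exists>W. openin (strong_uniform_topology \<BB>) W \<and> f \<in> W \<and> W \<subseteq> - A)"
    using assms(2) by (auto simp: in_closure_of topspace_strong_uniform_topology[OF assms(1)])
  also have "\<dots> \<longleftrightarrow> (\<forall>B\<in>\<BB>. \<forall>\<epsilon>>0. \<exists>g\<in>A. g \<in> strong_nbhd B \<epsilon> f)"
    unfolding strong_uniform_topology_local_base[OF assms] by blast
  finally show ?thesis .
qed

lemma Omega_at_strong_uniform_topology: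
  assumes "bornology \<BB>" "f \<in> cont_funs"
  shows "A \<in> Omega_at (strong_uniform_topology \<BB>) f \<longleftrightarrow>
    A \<subseteq> cont_funs - {f} \<and> (\<forall>B\<in>\<BB>. \<forall>\<epsilon>>0. \<exists>g\<in>A. g \<in> strong_nbhd B \<epsilon> f)"
  unfolding Omega_at_def topspace_strong_uniform_topology[OF assms(1)] mem_Collect_eq
    in_closure_of_strong_uniform_topology[OF assms] ..

section \<open>From fan tightness to the selection principle\<close>

lemma Omega_at_functions_one_off_cover:
  assumes "bornology \<BB>" "strong_cover \<BB> \<U>"
  shows "{g \<in> cont_funs. \<exists>U\<in>\<U>. \<forall>x. x \<notin> U \<longrightarrow> g x = 1}
    \<in> Omega_at (strong_uniform_topology \<BB>) (\<lambda>x. 0)" (is "?A \<in> _")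
proof -
  have zero: "(\<lambda>x. 0) \<in> cont_funs"
    by (simp add: cont_funs_def)
  have "(\<lambda>x. 0) \<notin> ?A"
  proof
    assume "(\<lambda>x. 0) \<in> ?A"
    then obtain U where "U \<in> \<U>" "\<forall>x. x \<in> U"
      by auto
    then have "UNIV \<in> \<U>"
      by (metis UNIV_eq_I)
    then show False
      using assms(2) by (simp add: strong_cover_def)
  qed
  moreover have "\<exists>g\<in>?A. g \<in> strong_nbhd B \<epsilon> (\<lambda>x. 0)" if B: "B \<in> \<BB>" and "\<epsilon> > 0" for B \<epsilon>
  proof -
    have "B \<noteq> {}"
      using assms(1) B unfolding bornology_def by blast
    obtain U \<delta> where U: "U \<in> \<U>" "\<delta> > 0" "enlargement B \<delta> \<subseteq> U"
      using assms(2) B unfolding strong_cover_def by blast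
    \<comment> \<open>Rescaled and truncated distance to \<open>B\<close>: it vanishes on
      \<open>B\<close> and reaches 1 at distance \<delta>, hence equals 1 off
      \<open>U\<close>.\<close>
    define g where "g = (\<lambda>x. min 1 (infdist x B / \<delta>))"
    have g: "g \<in> cont_funs"
      unfolding g_def cont_funs_def using U by (auto intro!: continuous_intros)
    have "g x = 1" if "x \<notin> U" for x
    proof -
      have "\<not> infdist x B < \<delta>"
        using that U mem_enlargement_iff_infdist[OF \<open>B \<noteq> {}\<close>] by blast
      then show ?thesis
        using U by (simp add: g_def min_def field_simps)
    qed
    then have "g \<in> ?A"
      using g U by blast
    \<comment> \<open>Because of the factor \<open>1 / \<delta>\<close> in \<open>g\<close>,
      distance below \<open>\<epsilon> * \<delta>\<close> gives values below \<epsilon>.\<close>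
    moreover have "\<bar>g x\<bar> < \<epsilon>" if "x \<in> enlargement B (\<epsilon> * \<delta>)" for x
    proof -
      have "infdist x B / \<delta> < \<epsilon>"
        using that U mem_enlargement_iff_infdist[OF \<open>B \<noteq> {}\<close>] by (simp add: field_simps)
      moreover have "infdist x B / \<delta> \<ge> 0"
        using U by (simp add: infdist_nonneg)
      ultimately show ?thesis
        by (simp add: g_def min_def)
    qed
    then have "g \<in> strong_nbhd B \<epsilon> (\<lambda>x. 0)"
      using g U \<open>\<epsilon> > 0\<close> unfolding strong_nbhd_def
      by (auto intro!: exI[of _ "\<epsilon> * \<delta>"])
    ultimately show ?thesis
      by blast
  qed
  ultimately show ?thesis
    unfolding Omega_at_strong_uniform_topology[OF assms(1) zero] by blast
qed

lemma S_finE: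
  fixes U :: "nat \<Rightarrow> 'b set"
  assumes "S_fin \<UU> \<VV>" "\<And>n. U n \<in> \<UU>"
  obtains V where "\<And>n. finite (V n)" "\<And>n. V n \<subseteq> U n" "(\<Union>n. V n) \<in> \<VV>"
proof -
  have "\<exists>V. (\<forall>n. finite (V n) \<and> V n \<subseteq> U n) \<and> (\<Union>n. V n) \<in> \<VV>"
    using assms(1)[unfolded S_fin_def, rule_format, of U] assms(2) by simp
  then show thesis
    using that by blast
qed

text \<open>Fan tightness at the zero function suffices: finitely many functions chosen from each
  \<open>A n\<close> are traded for the cover members off which they equal 1.\<close>

lemma fan_tightness_imp_S_fin:
  assumes "bornology \<BB>" "countable_fan_tightness (strong_uniform_topology \<BB>)"
  shows "S_fin (strong_covers \<BB>) (strong_covers \<BB>)"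
  unfolding S_fin_def
proof (intro allI impI)
  fix \<U> :: "nat \<Rightarrow> 'a set set"
  assume "\<forall>n. \<U> n \<in> strong_covers \<BB>"
  then have cov: "strong_cover \<BB> (\<U> n)" for n
    by (simp add: strong_covers_def)
  let ?Z = "strong_uniform_topology \<BB>"
  define A where "A n = {g \<in> cont_funs. \<exists>U\<in>\<U> n. \<forall>x. x \<notin> U \<longrightarrow> g x = (1::real)}" for n
  have zero: "(\<lambda>x::'a. 0::real) \<in> cont_funs"
    by (simp add: cont_funs_def)
  have "S_fin (Omega_at ?Z (\<lambda>x. 0)) (Omega_at ?Z (\<lambda>x. 0))"
    using assms zero by (simp add: countable_fan_tightness_def topspace_strong_uniform_topology)
  moreover have "A n \<in> Omega_at ?Z (\<lambda>x. 0)" for n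
    using Omega_at_functions_one_off_cover[OF assms(1) cov] by (simp add: A_def)
  ultimately obtain F where F: "\<And>n. finite (F n)" "\<And>n. F n \<subseteq> A n"
    and "(\<Union>n. F n) \<in> Omega_at ?Z (\<lambda>x. 0)"
    using S_finE[of "Omega_at ?Z (\<lambda>x. 0)" "Omega_at ?Z (\<lambda>x. 0)" A] by auto
  then have lim: "\<And>B \<epsilon>. B \<in> \<BB> \<Longrightarrow> \<epsilon> > 0 \<Longrightarrow> \<exists>n. \<exists>g\<in>F n. g \<in> strong_nbhd B \<epsilon> (\<lambda>x. 0)"
    unfolding Omega_at_strong_uniform_topology[OF assms(1) zero] by blast
  \<comment> \<open>The chosen member depends on \<open>n\<close> as well as \<open>g\<close>, since
    one function may be selected at several indices and must then give a member of each
    corresponding cover.\<close>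
  have "\<forall>n g. \<exists>U. g \<in> F n \<longrightarrow> U \<in> \<U> n \<and> (\<forall>x. x \<notin> U \<longrightarrow> g x = 1)"
    using F(2) unfolding A_def by blast
  then obtain u where "\<forall>n g. g \<in> F n \<longrightarrow> u n g \<in> \<U> n \<and> (\<forall>x. x \<notin> u n g \<longrightarrow> g x = 1)"
    unfolding choice_iff by blast
  then have u: "\<And>n g. g \<in> F n \<Longrightarrow> u n g \<in> \<U> n"
    "\<And>n g x. g \<in> F n \<Longrightarrow> x \<notin> u n g \<Longrightarrow> g x = 1"
    by simp_all
  have "strong_cover \<BB> (\<Union>n. u n ` F n)"
  proof (rule strong_coverI[OF assms(1)])
    show "open U" if "U \<in> (\<Union>n. u n ` F n)" for U
      using that u(1) cov unfolding strong_cover_def by blast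
    show "UNIV \<notin> (\<Union>n. u n ` F n)"
    proof
      assume "UNIV \<in> (\<Union>n. u n ` F n)"
      then obtain n where "UNIV \<in> \<U> n"
        using u(1) by fastforce
      then show False
        using cov[of n] by (simp add: strong_cover_def)
    qed
    fix B assume "B \<in> \<BB>"
    \<comment> \<open>Tolerance 1 is the right one: a point where \<open>g\<close> is below 1 in
      absolute value cannot lie off \<open>u n g\<close>.\<close>
    then obtain n g where g: "g \<in> F n" "g \<in> strong_nbhd B 1 (\<lambda>x. 0)"
      using lim zero_less_one by blast
    then obtain \<delta> where "\<delta> > 0" "\<forall>x\<in>enlargement B \<delta>. \<bar>g x\<bar> < 1"
      by (auto simp: strong_nbhd_def)
    moreover from this have "enlargement B \<delta> \<subseteq> u n g"
      using u(2)[OF g(1)] by force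
    ultimately show "\<exists>U\<in>\<Union>n. u n ` F n. \<exists>\<delta>>0. enlargement B \<delta> \<subseteq> U"
      using g(1) by blast
  qed
  moreover have "\<forall>n. finite (u n ` F n) \<and> u n ` F n \<subseteq> \<U> n"
    using F(1) u(1) by blast
  ultimately show "\<exists>V. (\<forall>n. finite (V n) \<and> V n \<subseteq> \<U> n) \<and> (\<Union>n. V n) \<in> strong_covers \<BB>"
    unfolding strong_covers_def by (intro exI[of _ "\<lambda>n. u n ` F n"]) simp
qed

section \<open>From the selection principle to fan tightness\<close>

lemma S_fin_imp_fan_tightness:
  fixes \<BB> :: "'a::metric_space set set"
  assumes "bornology \<BB>" "S_fin (strong_covers \<BB>) (strong_covers \<BB>)"
  shows "countable_fan_tightness (strong_uniform_topology \<BB>)"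
proof -
  let ?Z = "strong_uniform_topology \<BB>"
  have "\<exists>G. (\<forall>n. finite (G n) \<and> G n \<subseteq> A n) \<and> (\<Union>n. G n) \<in> Omega_at ?Z f"
    if f: "f \<in> cont_funs" and "\<forall>n. A n \<in> Omega_at ?Z f"
    for f and A :: "nat \<Rightarrow> ('a \<Rightarrow> real) set"
  proof -
    have A: "\<And>n. A n \<subseteq> cont_funs - {f}"
      "\<And>n B \<epsilon>. B \<in> \<BB> \<Longrightarrow> \<epsilon> > 0 \<Longrightarrow> \<exists>g\<in>A n. g \<in> strong_nbhd B \<epsilon> f"
      using that(2) unfolding Omega_at_strong_uniform_topology[OF assms(1) f] by auto
    define e where "e n = inverse (real (Suc n))" for n
    define S where "S n g = {x. \<bar>g x - f x\<bar> < e n}" for n g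
    have e_pos: "e n > 0" for n
      by (simp add: e_def)
    have e_small: "\<exists>k. \<forall>n\<ge>k. e n < \<epsilon>" if "\<epsilon> > 0" for \<epsilon>
      using order_tendstoD(2)[OF LIMSEQ_inverse_real_of_nat that]
      by (simp add: e_def eventually_sequentially)
    \<comment> \<open>Criterion shared by both cases. Arbitrarily large \<open>n\<close> are
      required because \<open>S n g\<close> only controls \<open>g\<close> up to \<open>e n\<close>,
      which must drop below a given \<epsilon>.\<close>
    have Omega: "(\<Union>n. G n) \<in> Omega_at ?Z f"
      if G: "\<And>n. G n \<subseteq> A n"
        and large: "\<And>B k. B \<in> \<BB> \<Longrightarrow> \<exists>n\<ge>k. \<exists>g\<in>G n. \<exists>\<delta>>0. enlargement B \<delta> \<subseteq> S n g" for G
    proof -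
      have "\<exists>g\<in>\<Union>n. G n. g \<in> strong_nbhd B \<epsilon> f" if B: "B \<in> \<BB>" and "\<epsilon> > 0" for B \<epsilon>
      proof -
        obtain k where k: "\<forall>n\<ge>k. e n < \<epsilon>"
          using e_small[OF \<open>\<epsilon> > 0\<close>] by blast
        obtain n g \<delta> where g: "n \<ge> k" "g \<in> G n" "\<delta> > 0" "enlargement B \<delta> \<subseteq> S n g"
          using large[OF B] by blast
        then have "\<forall>x\<in>enlargement B \<delta>. \<bar>g x - f x\<bar> < \<epsilon>"
          using k unfolding S_def by force
        then have "g \<in> strong_nbhd B \<epsilon> f"
          using g G A(1) unfolding strong_nbhd_def by blast
        then show ?thesis
          using g by blast
      qed
      then show ?thesis
        using G A(1) unfolding Omega_at_strong_uniform_topology[OF assms(1) f] by blast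
    qed
    show ?thesis
    proof (cases "\<forall>k. \<exists>n\<ge>k. UNIV \<in> S n ` A n")
      case True
      have "\<forall>n. \<exists>g. UNIV \<in> S n ` A n \<longrightarrow> g \<in> A n \<and> S n g = UNIV"
        by force
      then obtain h where h: "\<And>n. UNIV \<in> S n ` A n \<Longrightarrow> h n \<in> A n \<and> S n (h n) = UNIV"
        unfolding choice_iff by blast
      \<comment> \<open>One function per good index is enough: \<open>S n (h n) = UNIV\<close>
        bounds the error by \<open>e n\<close> everywhere, so any \<open>B\<close> and any radius
        will do.\<close>
      define G where "G n = (if UNIV \<in> S n ` A n then {h n} else {})" for n
      have large: "\<exists>n\<ge>k. \<exists>g\<in>G n. \<exists>\<delta>>0. enlargement B \<delta> \<subseteq> S n g" for B k
      proof -
        obtain n where "n \<ge> k" "UNIV \<in> S n ` A n"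
          using True by blast
        then show ?thesis
          using h[of n] by (intro exI[of _ n]) (auto simp: G_def intro: exI[of _ 1])
      qed
      have G: "G n \<subseteq> A n" "finite (G n)" for n
        using h[of n] by (auto simp: G_def)
      show ?thesis
        using Omega[OF G(1) large] G by blast
    next
      case False
      then obtain m where m: "\<And>n. n \<ge> m \<Longrightarrow> UNIV \<notin> S n ` A n"
        by blast
      have "strong_cover \<BB> (S n ` A n)" if "n \<ge> m" for n
      proof (rule strong_coverI[OF assms(1)])
        show "open U" if U: "U \<in> S n ` A n" for U
        proof -
          obtain g where "g \<in> A n" "U = S n g"
            using U by blast
          moreover from this have "continuous_on UNIV g" "continuous_on UNIV f"
            using A(1) f unfolding cont_funs_def by auto
          ultimately show ?thesis
            unfolding S_def by (auto intro!: open_Collect_less continuous_intros)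
        qed
        show "UNIV \<notin> S n ` A n"
          using m that .
        show "\<exists>U\<in>S n ` A n. \<exists>\<delta>>0. enlargement B \<delta> \<subseteq> U" if B: "B \<in> \<BB>" for B
        proof -
          \<comment> \<open>With tolerance exactly \<open>e n\<close>, membership in
            \<open>strong_nbhd\<close> says that some enlargement of \<open>B\<close> lies in
            \<open>S n g\<close>.\<close>
          obtain g where g: "g \<in> A n" "g \<in> strong_nbhd B (e n) f"
            using A(2)[OF B e_pos] by blast
          then obtain \<delta> where "\<delta> > 0" "enlargement B \<delta> \<subseteq> S n g"
            unfolding strong_nbhd_def S_def by blast
          then show ?thesis
            using g(1) by blast
        qed
      qed
      \<comment> \<open>The principle needs every term to be a strong cover, so the sequence starts
        at \<open>m\<close>.\<close>
      then have "S (m + n) ` A (m + n) \<in> strong_covers \<BB>" for n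
        unfolding strong_covers_def by simp
      then obtain V
        where V: "\<And>n. finite (V n)" "\<And>n. V n \<subseteq> S (m + n) ` A (m + n)"
          and "(\<Union>n. V n) \<in> strong_covers \<BB>"
        using S_finE[OF assms(2), of "\<lambda>n. S (m + n) ` A (m + n)"] by auto
      then have cov: "strong_cover \<BB> (\<Union>n. V n)"
        unfolding strong_covers_def by simp
      \<comment> \<open>Many functions may give the same open set, so a finite set of
        representatives is pulled back.\<close>
      have "\<exists>H. H \<subseteq> A (m + n) \<and> finite H \<and> V n = S (m + n) ` H" for n
        using finite_subset_image[OF V] by blast
      then obtain H where H: "\<And>n. H n \<subseteq> A (m + n)" "\<And>n. finite (H n)" "\<And>n. V n = S (m + n) ` H n"
        by metis
      \<comment> \<open>Undoes the shift by \<open>m\<close>; nothing is selected at earlier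
        indices.\<close>
      define G where "G n = (if n < m then {} else H (n - m))" for n
      have G: "G n \<subseteq> A n" "finite (G n)" for n
        using H(1,2)[of "n - m"] by (auto simp: G_def)
      have large: "\<exists>n\<ge>k. \<exists>g\<in>G n. \<exists>\<delta>>0. enlargement B \<delta> \<subseteq> S n g" if B: "B \<in> \<BB>" for B k
      proof -
        \<comment> \<open>A member avoiding this finite subfamily can only come from some
          \<open>V n\<close> with \<open>n \<ge> k\<close>, which puts its function at index
          \<open>m + n \<ge> k\<close>.\<close>
        have "finite (\<Union>n<k. V n)" "(\<Union>n<k. V n) \<subseteq> (\<Union>n. V n)"
          using V(1) by auto
        then obtain U \<delta> where U: "U \<in> (\<Union>n. V n) - (\<Union>n<k. V n)" "\<delta> > 0" "enlargement B \<delta> \<subseteq> U"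
          using strong_cover_avoid_finite[OF assms(1) cov B] by metis
        then obtain n where "U \<in> V n" "n \<ge> k"
          by (metis DiffE UN_E UN_I lessThan_iff not_less)
        then obtain g where "g \<in> H n" "U = S (m + n) g"
          using H(3) by blast
        then have "g \<in> G (m + n)" "m + n \<ge> k"
          using \<open>n \<ge> k\<close> by (auto simp: G_def)
        then show ?thesis
          using U \<open>U = S (m + n) g\<close> by blast
      qed
      show ?thesis
        using Omega[OF G(1) large] G by blast
    qed
  qed
  then show ?thesis
    unfolding countable_fan_tightness_def S_fin_def topspace_strong_uniform_topology[OF assms(1)]
    by blast
qed

theorem theorem2p4:
  fixes \<BB> :: "'a::metric_space set set"
  assumes "bornology \<BB>"
    and "has_closed_base \<BB>"
    and "UNIV \<notin> \<BB>"
    and "strong_Lindelof \<BB>"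
  shows "countable_fan_tightness (strong_uniform_topology \<BB>) \<longleftrightarrow>
         S_fin (strong_covers \<BB>) (strong_covers \<BB>)"
  using fan_tightness_imp_S_fin S_fin_imp_fan_tightness assms(1) by blast

end
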